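(* Consider $N>1$ robots and $M>0$ objects in the workspace $\mathcal W$ with regions of interest $\pi_1,\dots,\pi_K$, $K>1$, starting at $t=0$ from collision-free configurations with $\bar{\mathcal B}(x_i(0),r_i)\subset\pi_{\mathrm{init}(i)}$, $\bar{\mathcal B}(x^o_j(0),r^o_j)\subset\pi_{\mathrm{init}_o(j)}$, $\dot x_i(0)=0$, $\dot x^o_j(0)=0$ for all $i\in\mathcal N$, $j\in\mathcal M$. Let $\phi_i$ be an LTL formula over $\Psi_i$ ($i\in\mathcal N$) and $\phi^o_j$ an LTL formula over $\Psi^o_j$ ($j\in\mathcal M$), where all these sets of atomic propositions are pairwise disjoint, and let $\phi:=\big(\bigwedge_{i\in\mathcal N}\phi_i\big)\wedge\big(\bigwedge_{j\in\mathcal M}\phi^o_j\big)$. Let $\mathcal{TS}$ be the coupled transition system of the robots and objects. Let $\pi_{\mathrm{pl}}=\pi_{s,1}\pi_{s,2}\cdots$ be an infinite path of $\mathcal{TS}$ in prefix-suffix form $\pi_{\mathrm{pl}}^{\mathrm{pre}}[\pi_{\mathrm{pl}}^{\mathrm{suf}}]^\omega$, with $\pi_{s,1}\in\Pi_s^{\mathrm{init}}$ and $\pi_{s,\ell}\to_s\pi_{s,\ell+1}$ for all $\ell\ge 1$, whose trace $\psi_{\mathrm{pl}}=\mathcal L(\pi_{s,1})\mathcal L(\pi_{s,2})\cdots$ satisfies $\phi$. Then the execution of the path $(\pi_{\mathrm{pl}},\psi_{\mathrm{pl}})$ guarantees behaviors $\beta_i$ of every robot $i\in\mathcal N$ and $\beta^o_j$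 of every object $j\in\mathcal M$ such that $\beta_i$ satisfies $\phi_i$ and $\beta^o_j$ satisfies $\phi^o_j$. That is, for the trajectories $x_i(t)$, $x^o_j(t)$ produced by the execution there are strictly increasing time stamps $(t_{i,\ell})_{\ell\ge1}$, $(t^o_{j,\ell})_{\ell\ge1}$ in $[0,\infty)$ and sequences $\sigma_i=\sigma_{i,1}\sigma_{i,2}\cdots$, $\sigma^o_j=\sigma^o_{j,1}\sigma^o_{j,2}\cdots$ such that $\beta_i=(x_i(t_{i,1}),\sigma_{i,1})(x_i(t_{i,2}),\sigma_{i,2})\cdots$ and $\beta^o_j=(x^o_j(t^o_{j,1}),\sigma^o_{j,1})(x^o_j(t^o_{j,2}),\sigma^o_{j,2})\cdots$ are behaviors and $\sigma_i\models\phi_i$, $\sigma^o_j\models\phi^o_j$ for all $i\in\mathcal N$, $j\in\mathcal M$. Consequently, executing the path is a control strategy that achieves the satisfaction of all of the formulas $\phi_i$, $\phi^o_j$.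
   Context: **Workspace, robots, objects.** $\mathcal N=\{1,\dots,N\}$, $\mathcal M=\{1,\dots,M\}$, $\mathcal K=\{1,\dots,K\}$. The workspace $\mathcal W\subset\mathbb R^2$ is compact and contains finitely many connected closed obstacles $\mathfrak O_j$; $\mathcal W_{\mathrm f}$ is $\mathcal W$ minus the obstacles. $\bar{\mathcal B}(c,r)$ is the closed ball. The regions of interest are closed balls $\pi_k=\bar{\mathcal B}(p_{\pi_k},r_{\pi_k})\subset\mathcal W_{\mathrm f}$, and $\Pi=\{\pi_1,\dots,\pi_K\}$. Robot $i$ has position $x_i\in\mathbb R^2$, volume $\bar{\mathcal B}(x_i,r_i)$, an integer power capability $\zeta_i>0$, and dynamics $m_i\ddot x_i+f_i(x_i,\dot x_i)=u_i-h_i$ ($u_i$ the control input, $h_i$ the force exerted on a grasped object). Object $j$ has position $x^o_j\in\mathbb R^2$, volume $\bar{\mathcal B}(x^o_j,r^o_j)$, and dynamics $m^o_j\ddot x^o_j+f^o_j(x^o_j,\dot x^o_j)=h^o_j$, where $h^o_j$ is the total force from the robots grasping it. The masses are unknown; $f_i,f^o_j:\mathbb R^4\to\mathbb R^2$ are unknown analytic functions with $\|f_i(\mathsf x,\mathsf y)\|\le\alpha_i\|\mathsf y\|$ and $\|f^o_j(\mathsf x,\mathsf y)\|\le\alpha^o_j\|\mathsf y\|$ for unknown positive constants $\alpha_i,\alpha^o_j$. When a set $\mathcal A\subseteq\mathcal N$ of robots grasps object $j$ (rigidly), the offsets $x^o_j-x_i$, $i\in\mathcal A$, are constant, and the coupled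 system has as volume a ball centered at $x^o_j$ with radius $r_{\mathcal A,j}$ that contains the volumes of object $j$ and of all robots in $\mathcal A$. **Grasping configuration.** $\mathcal{AG}=(\mathcal{AG}_1,\dots,\mathcal{AG}_M)\in(2^{\mathcal N_0})^M$, $\mathcal N_0=\mathcal N\cup\{0\}$, where $\mathcal{AG}_j$ is the set of robots grasping object $j$ (the value $0$ means no robot grasps it). A robot grasps at most one object at a time. $\Lambda(m^o_j,\zeta_{\mathcal A})\in\{\mathsf{True},\mathsf{False}\}$ says whether the robots in $\mathcal A$ (with powers $\zeta_{\mathcal A}=(\zeta_i)_{i\in\mathcal A}$) are powerful enough to transport object $j$. $\mathcal P_{s,0}(r_{\pi_k},\rho_1,\dots,\rho_n)\in\{\mathsf{True},\mathsf{False}\}$ says whether pairwise non-intersecting balls of radii $\rho_1,\dots,\rho_n$ fit inside $\pi_k$. **Labels, behaviors.** $\mathcal L_i:\Pi\to2^{\Psi_i}$ and $\mathcal L^o_j:\Pi\to2^{\Psi^o_j}$ give the services (atomic propositions) provided in each region to robot $i$ and object $j$. A behavior of robot $i$ with trajectory $x_i(t)$ is an infinite sequence $(x_i(t_{i,1}),\sigma_{i,1})(x_i(t_{i,2}),\sigma_{i,2})\cdots$ with $0\le t_{i,1}<t_{i,2}<\cdots$ such that for every $\ell$ there is $k_{i,\ell}\in\mathcal K$ with $\bar{\mathcal B}(x_i(t_{i,\ell}),r_i)\subset\pi_{k_{i,\ell}}$ and $\sigma_{i,\ell}=\mathcal L_i(\pi_{k_{i,\ell}})$. A behavior of object $j$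 is defined in the same way with $x^o_j,r^o_j,\mathcal L^o_j$. A behavior satisfies an LTL formula if its sequence $\sigma$ does, with the standard LTL semantics over infinite words. **Transition system.** $\mathcal{TS}$ has the following components. *States* $\Pi_s$: tuples $\pi_s=(\pi_{k_1},\dots,\pi_{k_N},\pi_{k^o_1},\dots,\pi_{k^o_M},\mathcal{AG})$, with $k_i,k^o_j\in\mathcal K$ and $\mathcal{AG}\in(2^{\mathcal N_0})^M$, such that (a) for every $k\in\mathcal K$, $\mathcal P_{s,0}\big(r_{\pi_k},(r_i)_{i:k_i=k},(r^o_j)_{j:k^o_j=k}\big)=\mathsf{True}$; (b) $k_i=k^o_j$ whenever $i\in\mathcal{AG}_j$. *Initial states* $\Pi^{\mathrm{init}}_s\subset\Pi_s$: the states describing the system at $t=0$, so $k_i=\mathrm{init}(i)$, $k^o_j=\mathrm{init}_o(j)$ and $\mathcal{AG}$ is the grasping configuration at $t=0$. *Transitions* $\pi_s\to_s\tilde\pi_s$, where the components of $\tilde\pi_s$ are written $\tilde k_i,\tilde k^o_j,\widetilde{\mathcal{AG}}$, hold iff all of the following hold: 1. there are no $i,j$ such that $i$ belongs to exactly one of $\mathcal{AG}_j,\widetilde{\mathcal{AG}}_j$ and $k_i\neq\tilde k_i$; 2. there are no $i,j$ such that $i$ belongs to exactly one of $\mathcal{AG}_j,\widetilde{\mathcal{AG}}_j$ and $k_i=k^o_j\neq\tilde k_i=\tilde k^o_j$; 3. there are no $i$ and $j\ne j'$ with $i\in\mathcal{AG}_j$ and $i\in\widetilde{\mathcal{AG}}_{j'}$;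 4. there is no $j$ with $k^o_j\ne\tilde k^o_j$ such that no robot is in $\mathcal{AG}_j$ or no robot is in $\widetilde{\mathcal{AG}}_j$; 5. there is no $j$ with $k^o_j\neq\tilde k^o_j$ and $\Lambda(m^o_j,\zeta_{\mathcal A})=\mathsf{False}$, where $\mathcal A=\{i: i\in\mathcal{AG}_j\text{ and }i\in\widetilde{\mathcal{AG}}_j\}$. *Labels*: $\Psi=\bigcup_i\Psi_i\cup\bigcup_j\Psi^o_j$ and $\mathcal L(\pi_s)=\bigcup_{i}\mathcal L_i(\pi_{k_i})\cup\bigcup_j\mathcal L^o_j(\pi_{k^o_j})$. Transitions also carry nonnegative costs, which play no role in the claim. **Actions and execution.** Call "entity" a single non-grasping robot, a non-grasped object, or an object together with the robots grasping it. Each transition $\pi_s\to_s\tilde\pi_s$ prescribes these actions: robot $i$ navigates from $\pi_{k_i}$ to $\pi_{\tilde k_i}$ if it grasps nothing and $k_i\neq\tilde k_i$; object $j$ is transported from $\pi_{k^o_j}$ to $\pi_{\tilde k^o_j}$ by the robots grasping it if $k^o_j\neq\tilde k^o_j$; robot $i$ grasps (releases) object $j$ if $i\notin\mathcal{AG}_j,\ i\in\widetilde{\mathcal{AG}}_j$ (resp. $i\in\mathcal{AG}_j,\ i\notin\widetilde{\mathcal{AG}}_j$); otherwise a robot is idle. A navigation or transportation action of an entity from $\pi_k$ to $\pi_{k'}$ is achieved if in finite time the entity's volume becomes contained in $\pi_{k'}$, while along the way its volume does not meet the obstacles or the other entities. A grasp or release is achieved if in finite time the grasping configuration changes accordingly;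 robot bases are fixed during it. Standing fact: feedback control laws for the inputs $u_i$ are available that achieve each of these actions in finite time (adaptive feedback laws for robot navigation and cooperative object transportation, off-the-shelf laws for grasp and release). Moving entities are moved one at a time, the remaining ones being static; entities not being moved stay inside their current regions. The execution of a path $\pi_{s,1}\pi_{s,2}\cdots$ of $\mathcal{TS}$ means that, starting at $t=0$, the robots successively, for $\ell=1,2,\dots$, achieve with these control laws all actions prescribed by $\pi_{s,\ell}\to_s\pi_{s,\ell+1}$ before starting those of $\pi_{s,\ell+1}\to_s\pi_{s,\ell+2}$ (an idle step taking some positive time). The pair $(\pi_{\mathrm{pl}},\psi_{\mathrm{pl}})$ denotes a path together with its trace. *)

theory Defs
  imports "HOL-Analysis.Analysis" "HOL-Library.Omega_Words_Fun"
begin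

section \<open>Linear temporal logic over infinite words\<close>

datatype (atoms_ltl: 'a) ltl =
    LTrue
  | LAtom 'a
  | LNot "'a ltl"
  | LAnd "'a ltl" "'a ltl"
  | LNext "'a ltl"
  | LUntil "'a ltl" "'a ltl"

primrec ltl_sat :: "'a set word \<Rightarrow> 'a ltl \<Rightarrow> bool" (infix "\<Turnstile>" 50) where
  "w \<Turnstile> LTrue \<longleftrightarrow> True"
| "w \<Turnstile> LAtom a \<longleftrightarrow> a \<in> w 0"
| "w \<Turnstile> LNot f \<longleftrightarrow> \<not> w \<Turnstile> f"
| "w \<Turnstile> LAnd f g \<longleftrightarrow> w \<Turnstile> f \<and> w \<Turnstile> g"
| "w \<Turnstile> LNext f \<longleftrightarrow> suffix 1 w \<Turnstile> f"
| "w \<Turnstile> LUntil f g \<longleftrightarrow> (\<exists>n. suffix n w \<Turnstile> g \<and> (\<forall>m<n. suffix m w \<Turnstile> f))"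

definition ltl_Conj :: "'a ltl list \<Rightarrow> 'a ltl" where
  "ltl_Conj fs = foldr LAnd fs LTrue"


section \<open>Workspace, robots and objects\<close>

type_synonym vec2 = "real^2"

text \<open>
  A function is analytic if near every point it is the sum of a power series in the coordinates;
  the multi-indices are the functions from \<^term>\<open>Basis\<close> to the natural numbers.
\<close>

definition real_analytic :: "('a::euclidean_space \<Rightarrow> 'b::real_normed_vector) \<Rightarrow> bool" where
  "real_analytic f \<longleftrightarrow>
     (\<forall>z. \<exists>c. \<exists>\<epsilon>>0. \<forall>y\<in>ball 0 \<epsilon>.
        ((\<lambda>\<alpha>. (\<Prod>b\<in>Basis. (y \<bullet> b) ^ \<alpha> b) *\<^sub>R c \<alpha>) has_sum f (z + y))
          (Basis \<rightarrow>\<^sub>E (UNIV :: nat set)))"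

text \<open>
  Robots, objects and regions are numbered from 1. The drift terms take pairs (position, velocity),
  so their domain is a copy of four-dimensional space. The field \<open>coupled_rad A j\<close> is the radius
  of the ball enclosing object \<open>j\<close> together with the robots in \<open>A\<close> grasping it, and
  \<open>capable m z\<close> says whether robots with powers \<open>z\<close> (defined exactly on the
  robots concerned) can transport an object of mass \<open>m\<close>.
\<close>

record 'ap scenario =
  nR :: nat
  nO :: nat
  nK :: nat
  workspace :: "vec2 set"
  obstacles :: "vec2 set set"
  reg_ctr :: "nat \<Rightarrow> vec2"
  reg_rad :: "nat \<Rightarrow> real"
  radR :: "nat \<Rightarrow> real"
  radO :: "nat \<Rightarrow> real"
  coupled_rad :: "nat set \<Rightarrow> nat \<Rightarrow> real"
  massR :: "nat \<Rightarrow> real"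
  massO :: "nat \<Rightarrow> real"
  driftR :: "nat \<Rightarrow> vec2 \<times> vec2 \<Rightarrow> vec2"
  driftO :: "nat \<Rightarrow> vec2 \<times> vec2 \<Rightarrow> vec2"
  strength :: "nat \<Rightarrow> nat"
  capable :: "real \<Rightarrow> (nat \<rightharpoonup> nat) \<Rightarrow> bool"
  APR :: "nat \<Rightarrow> 'ap set"
  APO :: "nat \<Rightarrow> 'ap set"
  labR :: "nat \<Rightarrow> vec2 set \<Rightarrow> 'ap set"
  labO :: "nat \<Rightarrow> vec2 set \<Rightarrow> 'ap set"

definition robots :: "'ap scenario \<Rightarrow> nat set" where "robots S = {1..nR S}"
definition objects :: "'ap scenario \<Rightarrow> nat set" where "objects S = {1..nO S}"
definition regions :: "'ap scenario \<Rightarrow> nat set" where "regions S = {1..nK S}"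

definition region :: "'ap scenario \<Rightarrow> nat \<Rightarrow> vec2 set" where
  "region S k = cball (reg_ctr S k) (reg_rad S k)"

definition free_space :: "'ap scenario \<Rightarrow> vec2 set" where
  "free_space S = workspace S - \<Union>(obstacles S)"

definition admissible_drift :: "(vec2 \<times> vec2 \<Rightarrow> vec2) \<Rightarrow> bool" where
  "admissible_drift f \<longleftrightarrow>
     real_analytic f \<and> (\<exists>\<alpha>>0. \<forall>x y. norm (f (x, y)) \<le> \<alpha> * norm y)"

definition well_posed :: "'ap scenario \<Rightarrow> bool" where
  "well_posed S \<longleftrightarrow>
     nR S > 1 \<and> nO S > 0 \<and> nK S > 1 \<and>
     compact (workspace S) \<and> finite (obstacles S) \<and>
     (\<forall>B\<in>obstacles S. closed B \<and> connected B \<and> B \<subseteq> workspace S) \<and>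
     (\<forall>k\<in>regions S. 0 \<le> reg_rad S k \<and> region S k \<subseteq> free_space S) \<and>
     (\<forall>i\<in>robots S. 0 \<le> radR S i \<and> 0 < massR S i \<and> 0 < strength S i \<and> admissible_drift (driftR S i)) \<and>
     (\<forall>j\<in>objects S. 0 \<le> radO S j \<and> 0 < massO S j \<and> admissible_drift (driftO S j)) \<and>
     (\<forall>i\<in>robots S. \<forall>k\<in>regions S. labR S i (region S k) \<subseteq> APR S i) \<and>
     (\<forall>j\<in>objects S. \<forall>k\<in>regions S. labO S j (region S k) \<subseteq> APO S j)"


section \<open>The coupled transition system\<close>

text \<open>
  Tuples are functions that are \<^term>\<open>undefined\<close> outside their index set. The regions occupied
  are given by their numbers. A set \<open>grc s j\<close> may contain the marker 0, which is not a robot.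
\<close>

record tstate =
  regR :: "nat \<Rightarrow> nat"
  regO :: "nat \<Rightarrow> nat"
  grc :: "nat \<Rightarrow> nat set"

definition grasping_conf :: "'ap scenario \<Rightarrow> (nat \<Rightarrow> nat set) \<Rightarrow> bool" where
  "grasping_conf S G \<longleftrightarrow>
     G \<in> objects S \<rightarrow>\<^sub>E Pow (insert 0 (robots S)) \<and>
     disjoint_family_on (\<lambda>j. G j \<inter> robots S) (objects S)"

definition balls_fit :: "real \<Rightarrow> 'i set \<Rightarrow> ('i \<Rightarrow> real) \<Rightarrow> bool" where
  "balls_fit R I \<rho> \<longleftrightarrow>
     (\<exists>c :: 'i \<Rightarrow> vec2. (\<forall>a\<in>I. cball (c a) (\<rho> a) \<subseteq> cball 0 R) \<and>
        disjoint_family_on (\<lambda>a. cball (c a) (\<rho> a)) I)"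

definition ts_states :: "'ap scenario \<Rightarrow> tstate set" where
  "ts_states S = {s.
     regR s \<in> robots S \<rightarrow>\<^sub>E regions S \<and>
     regO s \<in> objects S \<rightarrow>\<^sub>E regions S \<and>
     grasping_conf S (grc s) \<and>
     (\<forall>k\<in>regions S.
        balls_fit (reg_rad S k) ({i\<in>robots S. regR s i = k} <+> {j\<in>objects S. regO s j = k})
          (case_sum (radR S) (radO S))) \<and>
     (\<forall>i\<in>robots S. \<forall>j\<in>objects S. i \<in> grc s j \<longrightarrow> regR s i = regO s j)}"

definition ts_init ::
  "'ap scenario \<Rightarrow> (nat \<Rightarrow> nat) \<Rightarrow> (nat \<Rightarrow> nat) \<Rightarrow> (nat \<Rightarrow> nat set) \<Rightarrow> tstate set" where
  "ts_init S ini inio G0 = {s \<in> ts_states S.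
     (\<forall>i\<in>robots S. regR s i = ini i) \<and> (\<forall>j\<in>objects S. regO s j = inio j) \<and>
     (\<forall>j\<in>objects S. grc s j \<inter> robots S = G0 j)}"

definition carriers :: "'ap scenario \<Rightarrow> tstate \<Rightarrow> tstate \<Rightarrow> nat \<Rightarrow> nat set" where
  "carriers S s s' j = {i\<in>robots S. i \<in> grc s j \<and> i \<in> grc s' j}"

definition ts_trans :: "'ap scenario \<Rightarrow> tstate \<Rightarrow> tstate \<Rightarrow> bool" where
  "ts_trans S s s' \<longleftrightarrow> s \<in> ts_states S \<and> s' \<in> ts_states S \<and>
     \<not> (\<exists>i\<in>robots S. \<exists>j\<in>objects S.
          (i \<in> grc s j) \<noteq> (i \<in> grc s' j) \<and> regR s i \<noteq> regR s' i) \<and>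
     \<not> (\<exists>i\<in>robots S. \<exists>j\<in>objects S.
          (i \<in> grc s j) \<noteq> (i \<in> grc s' j) \<and>
          regR s i = regO s j \<and> regO s j \<noteq> regR s' i \<and> regR s' i = regO s' j) \<and>
     \<not> (\<exists>i\<in>robots S. \<exists>j\<in>objects S. \<exists>j'\<in>objects S.
          j \<noteq> j' \<and> i \<in> grc s j \<and> i \<in> grc s' j') \<and>
     \<not> (\<exists>j\<in>objects S. regO s j \<noteq> regO s' j \<and>
          (grc s j \<inter> robots S = {} \<or> grc s' j \<inter> robots S = {})) \<and>
     \<not> (\<exists>j\<in>objects S. regO s j \<noteq> regO s' j \<and>
          \<not> capable S (massO S j) ((Some \<circ> strength S) |` carriers S s s' j))"

definition ts_label :: "'ap scenario \<Rightarrow> tstate \<Rightarrow> 'ap set" where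
  "ts_label S s =
     (\<Union>i\<in>robots S. labR S i (region S (regR s i))) \<union>
     (\<Union>j\<in>objects S. labO S j (region S (regO s j)))"


section \<open>Physical states and behaviors\<close>

text \<open>\<open>grasp q j\<close> is the set of robots that actually hold object \<open>j\<close>.\<close>

record pstate =
  posR :: "nat \<Rightarrow> vec2"
  velR :: "nat \<Rightarrow> vec2"
  posO :: "nat \<Rightarrow> vec2"
  velO :: "nat \<Rightarrow> vec2"
  grasp :: "nat \<Rightarrow> nat set"

definition volR :: "'ap scenario \<Rightarrow> pstate \<Rightarrow> nat \<Rightarrow> vec2 set" where
  "volR S q i = cball (posR q i) (radR S i)"

definition volO :: "'ap scenario \<Rightarrow> pstate \<Rightarrow> nat \<Rightarrow> vec2 set" where
  "volO S q j = cball (posO q j) (radO S j)"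

text \<open>
  Entities: \<^term>\<open>Inl i\<close> is the non-grasping robot \<open>i\<close>, and \<^term>\<open>Inr j\<close> is object \<open>j\<close> together
  with the robots grasping it, if any.
\<close>

definition entities :: "'ap scenario \<Rightarrow> pstate \<Rightarrow> (nat + nat) set" where
  "entities S q = {i\<in>robots S. \<forall>j\<in>objects S. i \<notin> grasp q j} <+> objects S"

definition vol :: "'ap scenario \<Rightarrow> pstate \<Rightarrow> nat + nat \<Rightarrow> vec2 set" where
  "vol S q e = (case e of
     Inl i \<Rightarrow> volR S q i
   | Inr j \<Rightarrow> if grasp q j = {} then volO S q j
             else cball (posO q j) (coupled_rad S (grasp q j) j))"

definition entity_clear :: "'ap scenario \<Rightarrow> pstate \<Rightarrow> nat + nat \<Rightarrow> bool" where
  "entity_clear S q e \<longleftrightarrow>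
     vol S q e \<inter> \<Union>(obstacles S) = {} \<and>
     (\<forall>e'\<in>entities S q - {e}. vol S q e \<inter> vol S q e' = {})"

definition collision_free :: "'ap scenario \<Rightarrow> pstate \<Rightarrow> bool" where
  "collision_free S q \<longleftrightarrow> (\<forall>e\<in>entities S q. entity_clear S q e)"

definition grasp_ok :: "'ap scenario \<Rightarrow> pstate \<Rightarrow> bool" where
  "grasp_ok S q \<longleftrightarrow>
     (\<forall>j\<in>objects S. grasp q j \<subseteq> robots S) \<and> disjoint_family_on (grasp q) (objects S) \<and>
     (\<forall>j\<in>objects S. grasp q j \<noteq> {} \<longrightarrow>
        volO S q j \<subseteq> vol S q (Inr j) \<and> (\<forall>i\<in>grasp q j. volR S q i \<subseteq> vol S q (Inr j)))"

text \<open>\<open>realises S q s\<close>: the discrete state \<open>s\<close> describes the physical state \<open>q\<close>.\<close>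

definition realises :: "'ap scenario \<Rightarrow> pstate \<Rightarrow> tstate \<Rightarrow> bool" where
  "realises S q s \<longleftrightarrow>
     (\<forall>i\<in>robots S. volR S q i \<subseteq> region S (regR s i)) \<and>
     (\<forall>j\<in>objects S. volO S q j \<subseteq> region S (regO s j)) \<and>
     (\<forall>j\<in>objects S. grasp q j = grc s j \<inter> robots S)"

text \<open>
  Behaviors of a ball of radius \<open>r\<close> with trajectory \<open>x\<close> and labelling \<open>L\<close>; \<open>D\<close> is the time
  domain of the trajectory, and sequences are numbered from 0.
\<close>

definition is_behavior ::
  "'ap scenario \<Rightarrow> real set \<Rightarrow> (real \<Rightarrow> vec2) \<Rightarrow> real \<Rightarrow> (vec2 set \<Rightarrow> 'ap set) \<Rightarrow>
   (vec2 \<times> 'ap set) word \<Rightarrow> bool" where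
  "is_behavior S D x r L \<beta> \<longleftrightarrow>
     (\<exists>t \<sigma>. strict_mono t \<and> (\<forall>l. 0 \<le> t l \<and> t l \<in> D) \<and>
        (\<forall>l. \<exists>k\<in>regions S. cball (x (t l)) r \<subseteq> region S k \<and> \<sigma> l = L (region S k)) \<and>
        \<beta> = (\<lambda>l. (x (t l), \<sigma> l)))"

definition behavior_sat :: "(vec2 \<times> 'ap set) word \<Rightarrow> 'ap ltl \<Rightarrow> bool" where
  "behavior_sat \<beta> f \<longleftrightarrow> (snd \<circ> \<beta>) \<Turnstile> f"


section \<open>Actions and their control\<close>

text \<open>
  \<open>Navigate i k k'\<close>; \<open>Transport j A k k'\<close>, where \<open>A\<close> are the transporting robots;
  \<open>Grasp i j\<close> and \<open>Release i j\<close> for robot \<open>i\<close> and object \<open>j\<close>.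
\<close>

datatype action =
    Navigate nat nat nat
  | Transport nat "nat set" nat nat
  | Grasp nat nat
  | Release nat nat
  | Idle

definition prescribed :: "'ap scenario \<Rightarrow> tstate \<Rightarrow> tstate \<Rightarrow> action set" where
  "prescribed S s s' =
     {Navigate i (regR s i) (regR s' i) | i.
        i \<in> robots S \<and> (\<forall>j\<in>objects S. i \<notin> grc s j) \<and> regR s i \<noteq> regR s' i} \<union>
     {Transport j (carriers S s s' j) (regO s j) (regO s' j) | j.
        j \<in> objects S \<and> regO s j \<noteq> regO s' j} \<union>
     {Grasp i j | i j. i \<in> robots S \<and> j \<in> objects S \<and> i \<notin> grc s j \<and> i \<in> grc s' j} \<union>
     {Release i j | i j. i \<in> robots S \<and> j \<in> objects S \<and> i \<in> grc s j \<and> i \<notin> grc s' j}"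

text \<open>An order in which the actions of a transition are performed one after the other.\<close>

definition is_schedule :: "'ap scenario \<Rightarrow> tstate \<Rightarrow> tstate \<Rightarrow> action list \<Rightarrow> bool" where
  "is_schedule S s s' acts \<longleftrightarrow> distinct acts \<and>
     set acts = (if prescribed S s s' = {} then {Idle} else prescribed S s s')"

primrec grasp_after :: "action \<Rightarrow> (nat \<Rightarrow> nat set) \<Rightarrow> (nat \<Rightarrow> nat set)" where
  "grasp_after (Navigate i k k') G = G"
| "grasp_after (Transport j A k k') G = G"
| "grasp_after (Grasp i j) G = G(j := insert i (G j))"
| "grasp_after (Release i j) G = G(j := G j - {i})"
| "grasp_after Idle G = G"

primrec moved_robots :: "action \<Rightarrow> nat set" where
  "moved_robots (Navigate i k k') = {i}"
| "moved_robots (Transport j A k k') = A"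
| "moved_robots (Grasp i j) = {}"
| "moved_robots (Release i j) = {}"
| "moved_robots Idle = {}"

primrec moved_objects :: "action \<Rightarrow> nat set" where
  "moved_objects (Navigate i k k') = {}"
| "moved_objects (Transport j A k k') = {j}"
| "moved_objects (Grasp i j) = {}"
| "moved_objects (Release i j) = {}"
| "moved_objects Idle = {}"

primrec moved_entities :: "action \<Rightarrow> (nat + nat) set" where
  "moved_entities (Navigate i k k') = {Inl i}"
| "moved_entities (Transport j A k k') = {Inr j}"
| "moved_entities (Grasp i j) = {}"
| "moved_entities (Release i j) = {}"
| "moved_entities Idle = {}"

primrec destination :: "action \<Rightarrow> nat" where
  "destination (Navigate i k k') = k'"
| "destination (Transport j A k k') = k'"
| "destination (Grasp i j) = undefined"
| "destination (Release i j) = undefined"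
| "destination Idle = undefined"

text \<open>
  The discrete description of the system after an action, used for the intermediate stages
  of a transition.
\<close>

definition state_after :: "action \<Rightarrow> tstate \<Rightarrow> tstate" where
  "state_after a s =
     \<lparr> regR = (\<lambda>i. if i \<in> moved_robots a then destination a else regR s i),
       regO = (\<lambda>j. if j \<in> moved_objects a then destination a else regO s j),
       grc = grasp_after a (grc s) \<rparr>"

text \<open>
  A feedback law yields the inputs of all robots from the time elapsed since it was switched on
  and the evolution of the physical state since then. It has no access to the masses and drift
  terms; dependence on the past covers adaptive laws, whose internal state is driven by the
  measured trajectory. Stopping the history at the current time makes every law causal.
\<close>

type_synonym feedback = "real \<Rightarrow> (real \<Rightarrow> pstate) \<Rightarrow> nat \<Rightarrow> vec2"

definition input :: "feedback \<Rightarrow> (real \<Rightarrow> pstate) \<Rightarrow> real \<Rightarrow> real \<Rightarrow> nat \<Rightarrow> vec2" where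
  "input \<mu> X t0 t = \<mu> (t - t0) (\<lambda>s. X (t0 + max 0 (min s (t - t0))))"

text \<open>
  The coupled dynamics on the interval from \<open>t0\<close> to \<open>t1\<close> with the grasps present at \<open>t0\<close>;
  \<open>h t i\<close> is the force exerted by robot \<open>i\<close>, and \<open>aR\<close>, \<open>aO\<close> are the accelerations.
\<close>

definition closed_loop :: "'ap scenario \<Rightarrow> feedback \<Rightarrow> (real \<Rightarrow> pstate) \<Rightarrow> real \<Rightarrow> real \<Rightarrow> bool" where
  "closed_loop S \<mu> X t0 t1 \<longleftrightarrow>
     (\<exists>h aR aO :: real \<Rightarrow> nat \<Rightarrow> vec2. \<forall>t\<in>{t0..t1}.
        (\<forall>i\<in>robots S.
           ((\<lambda>s. posR (X s) i) has_vector_derivative velR (X t) i) (at t within {t0..t1}) \<and>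
           ((\<lambda>s. velR (X s) i) has_vector_derivative aR t i) (at t within {t0..t1}) \<and>
           massR S i *\<^sub>R aR t i + driftR S i (posR (X t) i, velR (X t) i)
             = input \<mu> X t0 t i - h t i \<and>
           ((\<forall>j\<in>objects S. i \<notin> grasp (X t0) j) \<longrightarrow> h t i = 0)) \<and>
        (\<forall>j\<in>objects S.
           ((\<lambda>s. posO (X s) j) has_vector_derivative velO (X t) j) (at t within {t0..t1}) \<and>
           ((\<lambda>s. velO (X s) j) has_vector_derivative aO t j) (at t within {t0..t1}) \<and>
           massO S j *\<^sub>R aO t j + driftO S j (posO (X t) j, velO (X t) j)
             = (\<Sum>i\<in>grasp (X t0) j. h t i) \<and>
           (\<forall>i\<in>grasp (X t0) j.
              posO (X t) j - posR (X t) i = posO (X t0) j - posR (X t0) i)))"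

text \<open>
  Along \<open>X\<close>, the law for action \<open>a\<close>, switched on at \<open>t0\<close>, has achieved the action at \<open>t1\<close>.
  Everything that is not moved by the action is static, and a change of the grasping
  configuration takes effect at \<open>t1\<close>.
\<close>

definition achieves ::
  "'ap scenario \<Rightarrow> (action \<Rightarrow> feedback) \<Rightarrow> action \<Rightarrow> (real \<Rightarrow> pstate) \<Rightarrow> real \<Rightarrow> real \<Rightarrow> bool" where
  "achieves S law a X t0 t1 \<longleftrightarrow>
     t0 < t1 \<and>
     closed_loop S (law a) X t0 t1 \<and>
     (\<forall>t\<in>{t0..<t1}. grasp (X t) = grasp (X t0)) \<and>
     grasp (X t1) = grasp_after a (grasp (X t0)) \<and>
     (\<forall>t\<in>{t0..t1}.
        grasp_ok S (X t) \<and>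
        (\<forall>i\<in>robots S - moved_robots a. posR (X t) i = posR (X t0) i) \<and>
        (\<forall>j\<in>objects S - moved_objects a. posO (X t) j = posO (X t0) j) \<and>
        (\<forall>e\<in>moved_entities a. entity_clear S (X t) e)) \<and>
     (\<forall>j A k k'. a = Transport j A k k' \<longrightarrow> grasp (X t0) j = A) \<and>
     (\<forall>e\<in>moved_entities a. vol S (X t1) e \<subseteq> region S (destination a))"

text \<open>
  The laws achieve the actions \<open>acts\<close> of a transition from \<open>s\<close>, in this order. The set \<open>Q\<close> is the
  set of physical states in which the laws operate and in which they hand over to each other,
  for instance the collision-free states at rest.
\<close>

definition laws_available ::
  "'ap scenario \<Rightarrow> pstate set \<Rightarrow> (action \<Rightarrow> feedback) \<Rightarrow> tstate \<Rightarrow> action list \<Rightarrow> bool" where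
  "laws_available S Q law s acts \<longleftrightarrow>
     (\<forall>n<length acts. \<forall>q\<in>Q. realises S q (fold state_after (take n acts) s) \<longrightarrow>
        (\<exists>T>0. \<exists>X. X 0 = q \<and> achieves S law (acts ! n) X 0 T \<and> X T \<in> Q))"

text \<open>
  \<open>X\<close> is the trajectory of an execution starting at \<open>q0\<close> in which the actions \<open>sched l\<close> of the
  \<open>l\<close>-th transition are performed between the times \<open>\<tau> l\<close> and \<open>\<tau> (Suc l)\<close>.
\<close>

definition execution ::
  "'ap scenario \<Rightarrow> (action \<Rightarrow> feedback) \<Rightarrow> (nat \<Rightarrow> action list) \<Rightarrow> pstate \<Rightarrow>
   (real \<Rightarrow> pstate) \<Rightarrow> (nat \<Rightarrow> real) \<Rightarrow> bool" where
  "execution S law sched q0 X \<tau> \<longleftrightarrow>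
     X 0 = q0 \<and> \<tau> 0 = 0 \<and>
     (\<forall>l. \<exists>\<theta>. \<theta> 0 = \<tau> l \<and> \<theta> (length (sched l)) = \<tau> (Suc l) \<and>
        (\<forall>n<length (sched l). achieves S law (sched l ! n) X (\<theta> n) (\<theta> (Suc n))))"

definition exec_time :: "(nat \<Rightarrow> real) \<Rightarrow> real set" where
  "exec_time \<tau> = (\<Union>l. {0..\<tau> l})"

end

(*
  The laws lead from a physical state described by one discrete state to a physical state described
  by the next one, because all destinations occurring in a transition agree with its target; so
  every execution meets the regions of the path at the times at which its transitions are completed.
  Since the sets of atomic propositions are disjoint, the truth of each formula only depends on the
  part of the trace contributed by its own robot or object. Executions exist because the dynamics
  are time-invariant and the laws are causal, which allows to concatenate the trajectories of the
  single actions.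
*)
theory Submission
  imports Defs
begin

section \<open>Traces\<close>

lemma ltl_sat_ltl_Conj [simp]: "w \<Turnstile> ltl_Conj fs \<longleftrightarrow> (\<forall>f\<in>set fs. w \<Turnstile> f)"
  by (induction fs) (auto simp: ltl_Conj_def)

text \<open>A formula inspects a letter only through its own atoms. Both words are generalised in
  the induction because the temporal operators pass to suffixes, which inherit the letterwise
  agreement; a set \<open>A\<close> that may exceed the atoms serves all subformulas at
  once.\<close>

lemma ltl_sat_cong:
  assumes "atoms_ltl f \<subseteq> A" "\<And>l. w l \<inter> A = w' l \<inter> A"
  shows "w \<Turnstile> f \<longleftrightarrow> w' \<Turnstile> f"
  using assms
proof (induction f arbitrary: w w')
  case (LAtom a)
  then have "w 0 \<inter> A = w' 0 \<inter> A" "a \<in> A" by simp_all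
  then show ?case by auto
next
  case (LNot f)
  have "w \<Turnstile> f \<longleftrightarrow> w' \<Turnstile> f"
    by (rule LNot.IH) (use LNot.prems in simp_all)
  then show ?case by simp
next
  case (LAnd f g)
  have "w \<Turnstile> f \<longleftrightarrow> w' \<Turnstile> f"
    by (rule LAnd.IH(1)) (use LAnd.prems in simp_all)
  moreover have "w \<Turnstile> g \<longleftrightarrow> w' \<Turnstile> g"
    by (rule LAnd.IH(2)) (use LAnd.prems in simp_all)
  ultimately show ?case by simp
next
  case (LNext f)
  have "suffix 1 w \<Turnstile> f \<longleftrightarrow> suffix 1 w' \<Turnstile> f"
    by (rule LNext.IH) (use LNext.prems in simp_all)
  then show ?case by simp
next
  case (LUntil f g)
  have "suffix n w \<Turnstile> f \<longleftrightarrow> suffix n w' \<Turnstile> f" for n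
    by (rule LUntil.IH(1)) (use LUntil.prems in simp_all)
  moreover have "suffix n w \<Turnstile> g \<longleftrightarrow> suffix n w' \<Turnstile> g" for n
    by (rule LUntil.IH(2)) (use LUntil.prems in simp_all)
  ultimately show ?case by simp
qed simp

lemma ts_states_regions:
  assumes "s \<in> ts_states S"
  shows "i \<in> robots S \<Longrightarrow> regR s i \<in> regions S" "j \<in> objects S \<Longrightarrow> regO s j \<in> regions S"
  using assms by (auto simp: ts_states_def)

text \<open>\<open>well_posed\<close> confines each label to the propositions of its own robot or
  object, so disjointness removes every contribution but that of \<open>i\<close>. The intersection
  on the right gives the shape of the second premise of \<open>ltl_sat_cong\<close>.\<close>

lemma ts_label_Int_APR:
  assumes "well_posed S" "s \<in> ts_states S" "i \<in> robots S"
    and "disjoint_family_on (case_sum (APR S) (APO S)) (robots S <+> objects S)"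
  shows "ts_label S s \<inter> APR S i = labR S i (region S (regR s i)) \<inter> APR S i"
proof -
  have R: "labR S i' (region S (regR s i')) \<subseteq> APR S i'" if "i' \<in> robots S" for i'
    using assms(1) ts_states_regions[OF assms(2)] that unfolding well_posed_def by blast
  have O: "labO S j (region S (regO s j)) \<subseteq> APO S j" if "j \<in> objects S" for j
    using assms(1) ts_states_regions[OF assms(2)] that unfolding well_posed_def by blast
  have "APR S i' \<inter> APR S i = {}" if "i' \<in> robots S" "i' \<noteq> i" for i'
    using disjoint_family_onD[OF assms(4), of "Inl i'" "Inl i"] that assms(3) by auto
  moreover have "APO S j \<inter> APR S i = {}" if "j \<in> objects S" for j
    using disjoint_family_onD[OF assms(4), of "Inr j" "Inl i"] that assms(3) by auto
  ultimately show ?thesis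
    using R O assms(3) unfolding ts_label_def by blast
qed

lemma ts_label_Int_APO:
  assumes "well_posed S" "s \<in> ts_states S" "j \<in> objects S"
    and "disjoint_family_on (case_sum (APR S) (APO S)) (robots S <+> objects S)"
  shows "ts_label S s \<inter> APO S j = labO S j (region S (regO s j)) \<inter> APO S j"
proof -
  have R: "labR S i (region S (regR s i)) \<subseteq> APR S i" if "i \<in> robots S" for i
    using assms(1) ts_states_regions[OF assms(2)] that unfolding well_posed_def by blast
  have O: "labO S j' (region S (regO s j')) \<subseteq> APO S j'" if "j' \<in> objects S" for j'
    using assms(1) ts_states_regions[OF assms(2)] that unfolding well_posed_def by blast
  have "APO S j' \<inter> APO S j = {}" if "j' \<in> objects S" "j' \<noteq> j" for j'
    using disjoint_family_onD[OF assms(4), of "Inr j'" "Inr j"] that assms(3) by auto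
  moreover have "APR S i \<inter> APO S j = {}" if "i \<in> robots S" for i
    using disjoint_family_onD[OF assms(4), of "Inl i" "Inr j"] that assms(3) by auto
  ultimately show ?thesis
    using R O assms(3) unfolding ts_label_def by blast
qed


section \<open>Discrete effect of a transition\<close>

text \<open>As all actions moving \<open>i\<close> share one destination, neither their order nor
  their number matters.\<close>

lemma regR_fold_state_after:
  assumes "\<forall>a\<in>set acts. i \<in> moved_robots a \<longrightarrow> destination a = d"
  shows "regR (fold state_after acts s) i =
    (if \<exists>a\<in>set acts. i \<in> moved_robots a then d else regR s i)"
  using assms by (induction acts arbitrary: s) (auto simp: state_after_def)

lemma regO_fold_state_after:
  assumes "\<forall>a\<in>set acts. j \<in> moved_objects a \<longrightarrow> destination a = d"
  shows "regO (fold state_after acts s) j =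
    (if \<exists>a\<in>set acts. j \<in> moved_objects a then d else regO s j)"
  using assms by (induction acts arbitrary: s) (auto simp: state_after_def)

lemma mem_grasp_after:
  "i \<in> grasp_after a G j \<longleftrightarrow> a = Grasp i j \<or> (i \<in> G j \<and> a \<noteq> Release i j)"
  by (cases a) auto

text \<open>The truth value \<open>b\<close> is the membership aimed at. The two premises exclude a
  list that both grasps and releases the same pair, which makes the result independent of the
  order.\<close>

lemma grc_fold_state_after:
  assumes "Grasp i j \<in> set acts \<Longrightarrow> b" "Release i j \<in> set acts \<Longrightarrow> \<not> b"
  shows "i \<in> grc (fold state_after acts s) j \<longleftrightarrow>
    (if Grasp i j \<in> set acts \<or> Release i j \<in> set acts then b else i \<in> grc s j)"
  using assms by (induction acts arbitrary: s) (auto simp: state_after_def mem_grasp_after)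

lemma mem_prescribed_iff [simp]:
  "Navigate i k k' \<in> prescribed S s s' \<longleftrightarrow> i \<in> robots S \<and> (\<forall>j\<in>objects S. i \<notin> grc s j) \<and>
     regR s i \<noteq> regR s' i \<and> k = regR s i \<and> k' = regR s' i"
  "Transport j A k k' \<in> prescribed S s s' \<longleftrightarrow> j \<in> objects S \<and> regO s j \<noteq> regO s' j \<and>
     A = carriers S s s' j \<and> k = regO s j \<and> k' = regO s' j"
  "Grasp i j \<in> prescribed S s s' \<longleftrightarrow>
     i \<in> robots S \<and> j \<in> objects S \<and> i \<notin> grc s j \<and> i \<in> grc s' j"
  "Release i j \<in> prescribed S s s' \<longleftrightarrow>
     i \<in> robots S \<and> j \<in> objects S \<and> i \<in> grc s j \<and> i \<notin> grc s' j"
  "Idle \<notin> prescribed S s s'"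
  by (auto simp: prescribed_def)

lemma is_schedule_mem_iff:
  assumes "is_schedule S s s' acts" "a \<noteq> Idle"
  shows "a \<in> set acts \<longleftrightarrow> a \<in> prescribed S s s'"
  using assms by (auto simp: is_schedule_def split: if_splits)

text \<open>\<open>Idle\<close> stands in when nothing is prescribed. Thus every transition takes
  positive time and owns at least one numbered action.\<close>

lemma is_schedule_nonempty: "is_schedule S s s' acts \<Longrightarrow> acts \<noteq> []"
  by (auto simp: is_schedule_def split: if_splits)

lemma moved_not_Idle [simp]:
  "i \<in> moved_robots a \<Longrightarrow> a \<noteq> Idle" "j \<in> moved_objects a \<Longrightarrow> a \<noteq> Idle"
  by auto

text \<open>A robot changes region either by navigating or as a carrier. In the second case its
  target is fixed through the object, and the states \<open>s\<close> and \<open>s'\<close> place a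
  robot in the region of the object it grasps.\<close>

lemma regR_after_schedule:
  assumes tr: "ts_trans S s s'" and sch: "is_schedule S s s' acts" and i: "i \<in> robots S"
  shows "regR (fold state_after acts s) i = regR s' i"
proof -
  have grc: "regR u i = regO u j" if "i \<in> grc u j" "j \<in> objects S" "u = s \<or> u = s'" for u j
    using tr i that by (auto simp: ts_trans_def ts_states_def)
  have "destination a = regR s' i" if "a \<in> set acts" "i \<in> moved_robots a" for a
  proof -
    have "a \<in> prescribed S s s'" using that is_schedule_mem_iff[OF sch] by simp
    then show ?thesis
      \<comment> \<open>A carrier of \<open>j\<close> still holds \<open>j\<close> in
        \<open>s'\<close>, so the destination \<open>regO s' j\<close> of the transport equals
        \<open>regR s' i\<close>.\<close>
      using that(2) grc[where u = s'] by (cases a) (auto simp: carriers_def)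
  qed
  moreover have "\<exists>a\<in>set acts. i \<in> moved_robots a" if ne: "regR s i \<noteq> regR s' i"
  proof (cases "\<exists>j\<in>objects S. i \<in> grc s j")
    case True
    then obtain j where j: "j \<in> objects S" "i \<in> grc s j" by blast
    \<comment> \<open>The first condition on transitions: a robot that changes region keeps its
      grasps.\<close>
    then have j': "i \<in> grc s' j"
      using tr ne i unfolding ts_trans_def by blast
    then have "Transport j (carriers S s s' j) (regO s j) (regO s' j) \<in> set acts"
      using j ne grc by (auto simp: is_schedule_mem_iff[OF sch])
    moreover have "i \<in> carriers S s s' j" using i j j' by (auto simp: carriers_def)
    ultimately show ?thesis by force
  next
    case False
    then have "Navigate i (regR s i) (regR s' i) \<in> set acts"
      using ne i by (auto simp: is_schedule_mem_iff[OF sch])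
    then show ?thesis by force
  qed
  ultimately show ?thesis
    by (subst regR_fold_state_after[where d = "regR s' i"]) auto
qed

lemma regO_after_schedule:
  assumes sch: "is_schedule S s s' acts" and j: "j \<in> objects S"
  shows "regO (fold state_after acts s) j = regO s' j"
proof -
  have "destination a = regO s' j" if "a \<in> set acts" "j \<in> moved_objects a" for a
  proof -
    have "a \<in> prescribed S s s'" using that is_schedule_mem_iff[OF sch] by simp
    then show ?thesis using that(2) by (cases a) auto
  qed
  moreover have "\<exists>a\<in>set acts. j \<in> moved_objects a" if "regO s j \<noteq> regO s' j"
  proof -
    have "Transport j (carriers S s s' j) (regO s j) (regO s' j) \<in> set acts"
      using j that by (auto simp: is_schedule_mem_iff[OF sch])
    then show ?thesis by force
  qed
  ultimately show ?thesis
    by (subst regO_fold_state_after[where d = "regO s' j"]) auto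
qed

text \<open>Only robots are compared: no prescribed action concerns the marker 0, whose membership
  therefore stays that of \<open>s\<close>.\<close>

lemma grc_after_schedule:
  assumes sch: "is_schedule S s s' acts" and "j \<in> objects S"
  shows "grc (fold state_after acts s) j \<inter> robots S = grc s' j \<inter> robots S"
proof -
  have "i \<in> grc (fold state_after acts s) j \<longleftrightarrow> i \<in> grc s' j" if "i \<in> robots S" for i
    by (subst grc_fold_state_after[where b = "i \<in> grc s' j"])
      (use that assms(2) in \<open>auto simp: is_schedule_mem_iff[OF sch]\<close>)
  then show ?thesis by auto
qed

lemma realises_after_schedule:
  assumes "ts_trans S s s'" "is_schedule S s s' acts" "realises S q (fold state_after acts s)"
  shows "realises S q s'"
  using assms(3) unfolding realises_def
  by (simp add: regR_after_schedule[OF assms(1,2)] regO_after_schedule[OF assms(2)]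
      grc_after_schedule[OF assms(2)])


section \<open>Physical effect of actions\<close>

lemma achievesD:
  assumes "achieves S law a X t0 t1"
  shows "t0 < t1" "closed_loop S (law a) X t0 t1"
    "grasp (X t1) = grasp_after a (grasp (X t0))"
    "t \<in> {t0..<t1} \<Longrightarrow> grasp (X t) = grasp (X t0)"
    "t \<in> {t0..t1} \<Longrightarrow> grasp_ok S (X t)"
    "\<lbrakk>t \<in> {t0..t1}; i \<in> robots S - moved_robots a\<rbrakk> \<Longrightarrow> posR (X t) i = posR (X t0) i"
    "\<lbrakk>t \<in> {t0..t1}; j \<in> objects S - moved_objects a\<rbrakk> \<Longrightarrow> posO (X t) j = posO (X t0) j"
    "\<lbrakk>t \<in> {t0..t1}; e \<in> moved_entities a\<rbrakk> \<Longrightarrow> entity_clear S (X t) e"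
    "a = Transport j A k k' \<Longrightarrow> grasp (X t0) j = A"
    "e \<in> moved_entities a \<Longrightarrow> vol S (X t1) e \<subseteq> region S (destination a)"
proof -
  note * = assms[unfolded achieves_def]
  show "t0 < t1" using * by (rule conjunct1)
  show "closed_loop S (law a) X t0 t1" using * by (elim conjE)
  show "grasp (X t1) = grasp_after a (grasp (X t0))" using * by (elim conjE)
  show "grasp (X t) = grasp (X t0)" if "t \<in> {t0..<t1}"
    using * that by (elim conjE) (rule bspec)
  have mid: "\<forall>t\<in>{t0..t1}.
        grasp_ok S (X t) \<and>
        (\<forall>i\<in>robots S - moved_robots a. posR (X t) i = posR (X t0) i) \<and>
        (\<forall>j\<in>objects S - moved_objects a. posO (X t) j = posO (X t0) j) \<and>
        (\<forall>e\<in>moved_entities a. entity_clear S (X t) e)"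
    using * by (elim conjE)
  show "grasp_ok S (X t)" if "t \<in> {t0..t1}" using bspec[OF mid that] by (rule conjunct1)
  show "posR (X t) i = posR (X t0) i" if "t \<in> {t0..t1}" "i \<in> robots S - moved_robots a"
    using bspec[OF mid that(1)] that(2) by (elim conjE) (rule bspec)
  show "posO (X t) j = posO (X t0) j" if "t \<in> {t0..t1}" "j \<in> objects S - moved_objects a"
    using bspec[OF mid that(1)] that(2) by (elim conjE) (rule bspec)
  show "entity_clear S (X t) e" if "t \<in> {t0..t1}" "e \<in> moved_entities a"
    using bspec[OF mid that(1)] that(2) by (elim conjE) (rule bspec)
  have tr: "\<forall>j A k k'. a = Transport j A k k' \<longrightarrow> grasp (X t0) j = A"
    using * by (elim conjE)
  show "grasp (X t0) j = A" if "a = Transport j A k k'" using tr that by blast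
  have dest: "\<forall>e\<in>moved_entities a. vol S (X t1) e \<subseteq> region S (destination a)"
    using * by (elim conjE)
  show "vol S (X t1) e \<subseteq> region S (destination a)" if "e \<in> moved_entities a"
    using dest that by (rule bspec)
qed

text \<open>What is not moved is static, and a moved entity ends inside its destination together
  with all its members. The description \<open>s\<close> is arbitrary because intermediate stages of
  a transition need not be states of the transition system.\<close>

lemma realises_achieves:
  assumes ach: "achieves S law a X t0 t1" and re: "realises S (X t0) s"
    and a: "a \<in> prescribed S u u' \<or> a = Idle"
  shows "realises S (X t1) (state_after a s)"
proof -
  let ?s = "state_after a s"
  have t: "t1 \<in> {t0..t1}" using achievesD(1)[OF ach] by simp
  note ok = achievesD(5)[OF ach t] and stR = achievesD(6)[OF ach t]
    and stO = achievesD(7)[OF ach t] and G = achievesD(3)[OF ach] and dest = achievesD(10)[OF ach]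
  \<comment> \<open>A transport leaves the grasps unchanged, so the robots holding \<open>j\<close>
    at the end are exactly those counted as moved.\<close>
  have tp: "grasp (X t1) j = A" if "a = Transport j A k k'" for j A k k'
    using achievesD(9)[OF ach that] that by (simp add: G)
  have "volO S (X t1) j \<subseteq> region S (regO ?s j)" if j: "j \<in> objects S" for j
  proof (cases "j \<in> moved_objects a")
    case True
    then have "vol S (X t1) (Inr j) \<subseteq> region S (destination a)"
      by (intro dest, cases a) auto
    \<comment> \<open>A bare object is its own entity; otherwise \<open>grasp_ok\<close> puts it
      inside the enclosing ball.\<close>
    moreover have "volO S (X t1) j \<subseteq> vol S (X t1) (Inr j)"
    proof (cases "grasp (X t1) j = {}")
      case True
      then show ?thesis by (simp add: vol_def)
    next
      case False
      then show ?thesis using ok j unfolding grasp_ok_def by blast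
    qed
    ultimately show ?thesis using True by (auto simp: state_after_def)
  next
    case False
    then show ?thesis
      using re j stO[of j] by (auto simp: realises_def state_after_def volO_def)
  qed
  moreover have "volR S (X t1) i \<subseteq> region S (regR ?s i)"
    if i: "i \<in> robots S" for i
  proof (cases "i \<in> moved_robots a")
    case True
    then have "volR S (X t1) i \<subseteq> region S (destination a)"
    proof (cases a)
      case (Navigate i' k k')
      then show ?thesis using True dest[of "Inl i"] by (auto simp: vol_def)
    next
      case (Transport j A k k')
      then have "j \<in> objects S" "i \<in> grasp (X t1) j" using a True tp by auto
      then have "volR S (X t1) i \<subseteq> vol S (X t1) (Inr j)"
        using ok unfolding grasp_ok_def by blast
      also have "\<dots> \<subseteq> region S (destination a)" using Transport by (intro dest) simp
      finally show ?thesis .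
    qed auto
    then show ?thesis using True by (simp add: state_after_def)
  next
    case False
    then show ?thesis
      using re i stR[of i] by (auto simp: realises_def state_after_def volR_def)
  qed
  \<comment> \<open>Being prescribed, a \<open>Grasp\<close> adds only a robot, so intersecting with
    \<open>robots S\<close> commutes with the update.\<close>
  moreover have "grasp (X t1) j = grc ?s j \<inter> robots S" if "j \<in> objects S" for j
    using re that a unfolding G
    by (auto simp: realises_def state_after_def mem_grasp_after)
  ultimately show ?thesis
    by (auto simp: realises_def)
qed

section \<open>Executions follow the path\<close>

lemma execution_realises:
  assumes ex: "execution S law sched q0 X \<tau>" and "realises S q0 (\<pi> 0)"
    and tr: "\<forall>l. ts_trans S (\<pi> l) (\<pi> (Suc l))"
    and sch: "\<forall>l. is_schedule S (\<pi> l) (\<pi> (Suc l)) (sched l)"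
  shows "realises S (X (\<tau> l)) (\<pi> l)" "\<tau> l < \<tau> (Suc l)"
proof -
  have step: "\<tau> l < \<tau> (Suc l) \<and>
      (realises S (X (\<tau> l)) (\<pi> l) \<longrightarrow> realises S (X (\<tau> (Suc l))) (\<pi> (Suc l)))" for l
  proof -
    define acts where "acts = sched l"
    obtain \<theta> where \<theta>: "\<theta> 0 = \<tau> l" "\<theta> (length acts) = \<tau> (Suc l)"
      and ach: "\<And>n. n < length acts \<Longrightarrow> achieves S law (acts ! n) X (\<theta> n) (\<theta> (Suc n))"
      using ex unfolding execution_def acts_def by blast
    have schl: "is_schedule S (\<pi> l) (\<pi> (Suc l)) acts" using sch by (simp add: acts_def)
    have "\<theta> 0 < \<theta> n" if "n \<le> length acts" "n > 0" for n
      using that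
    proof (induction n)
      case (Suc n)
      have "\<theta> n < \<theta> (Suc n)" using achievesD(1)[OF ach[of n]] Suc.prems by simp
      then show ?case using Suc by (cases "n = 0") auto
    qed simp
    then have "\<tau> l < \<tau> (Suc l)"
      using \<theta> is_schedule_nonempty[OF schl] by (metis length_greater_0_conv order_refl)
    moreover have "realises S (X (\<tau> (Suc l))) (\<pi> (Suc l))" if re: "realises S (X (\<tau> l)) (\<pi> l)"
    proof -
      \<comment> \<open>Inner induction over the actions already performed; at
        \<open>n = length acts\<close> the stage agrees with \<open>\<pi> (Suc l)\<close> on robots
        and objects.\<close>
      have "realises S (X (\<theta> n)) (fold state_after (take n acts) (\<pi> l))"
        if "n \<le> length acts" for n
        using that
      proof (induction n)
        case 0
        then show ?case using re \<theta> by simp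
      next
        case (Suc n)
        have "acts ! n \<in> prescribed S (\<pi> l) (\<pi> (Suc l)) \<or> acts ! n = Idle"
          using is_schedule_mem_iff[OF schl, of "acts ! n"] Suc.prems by auto
        then show ?case
          using realises_achieves[OF ach[of n] Suc.IH] Suc.prems
          by (auto simp: take_Suc_conv_app_nth)
      qed
      from this[of "length acts"] show ?thesis
        using realises_after_schedule[OF _ schl] tr \<theta> by auto
    qed
    ultimately show ?thesis by blast
  qed
  show "\<tau> l < \<tau> (Suc l)" using step by blast
  show "realises S (X (\<tau> l)) (\<pi> l)"
  proof (induction l)
    case 0
    then show ?case using ex assms(2) by (simp add: execution_def)
  qed (use step in blast)
qed


section \<open>Concatenation of trajectories\<close>

text \<open>The chain rule for a translation, whose derivative is 1. Agreement on the interval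
  suffices since the derivative is taken within it, one-sidedly at the end points.\<close>

lemma has_vector_derivative_shift:
  fixes f g :: "real \<Rightarrow> 'a::real_normed_vector"
  assumes f: "(f has_vector_derivative v) (at (t - t0) within {0..T})"
    and "t \<in> {t0..t0 + T}" "\<And>s. s \<in> {t0..t0 + T} \<Longrightarrow> g s = f (s - t0)"
  shows "(g has_vector_derivative v) (at t within {t0..t0 + T})"
proof -
  have "(\<lambda>s. s - t0) ` {t0..t0 + T} = {0..T}" by auto
  then have "(f has_vector_derivative v) (at (t - t0) within (\<lambda>s. s - t0) ` {t0..t0 + T})"
    using f by simp
  moreover have "((\<lambda>s. s - t0) has_vector_derivative 1) (at t within {t0..t0 + T})"
    by (auto intro!: derivative_eq_intros)
  ultimately have "((f \<circ> (\<lambda>s. s - t0)) has_vector_derivative 1 *\<^sub>R v) (at t within {t0..t0 + T})"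
    by (intro vector_diff_chain_within)
  then show ?thesis
    using has_vector_derivative_transform[of t "{t0..t0+T}" g "f \<circ> (\<lambda>s. s - t0)" v]
      assms(2,3) by auto
qed

text \<open>The equations do not mention absolute time, and a law sees only the elapsed time and the
  history since it was switched on.\<close>

lemma closed_loop_shift:
  assumes cl: "closed_loop S \<mu> Y 0 T" and T: "0 \<le> T"
    and eq: "\<And>s. s \<in> {t0..t0 + T} \<Longrightarrow> X s = Y (s - t0)"
  shows "closed_loop S \<mu> X t0 (t0 + T)"
proof -
  obtain h aR aO :: "real \<Rightarrow> nat \<Rightarrow> vec2" where *: "\<forall>t\<in>{0..T}.
        (\<forall>i\<in>robots S.
           ((\<lambda>s. posR (Y s) i) has_vector_derivative velR (Y t) i) (at t within {0..T}) \<and>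
           ((\<lambda>s. velR (Y s) i) has_vector_derivative aR t i) (at t within {0..T}) \<and>
           massR S i *\<^sub>R aR t i + driftR S i (posR (Y t) i, velR (Y t) i)
             = input \<mu> Y 0 t i - h t i \<and>
           ((\<forall>j\<in>objects S. i \<notin> grasp (Y 0) j) \<longrightarrow> h t i = 0)) \<and>
        (\<forall>j\<in>objects S.
           ((\<lambda>s. posO (Y s) j) has_vector_derivative velO (Y t) j) (at t within {0..T}) \<and>
           ((\<lambda>s. velO (Y s) j) has_vector_derivative aO t j) (at t within {0..T}) \<and>
           massO S j *\<^sub>R aO t j + driftO S j (posO (Y t) j, velO (Y t) j)
             = (\<Sum>i\<in>grasp (Y 0) j. h t i) \<and>
           (\<forall>i\<in>grasp (Y 0) j. posO (Y t) j - posR (Y t) i = posO (Y 0) j - posR (Y 0) i))"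
    using cl unfolding closed_loop_def by (elim exE)
  have X0: "X t0 = Y 0" using eq[of t0] T by simp
  have input: "input \<mu> X t0 t = input \<mu> Y 0 (t - t0)" if t: "t \<in> {t0..t0 + T}" for t
  proof -
    \<comment> \<open>Clamping keeps the argument between \<open>t0\<close> and \<open>t\<close>,
      where \<open>X\<close> is known to be the shifted \<open>Y\<close>; this is where causality
      enters.\<close>
    have "X (t0 + max 0 (min s (t - t0))) = Y (0 + max 0 (min s (t - t0 - 0)))" for s
      using t by (subst eq) auto
    then show ?thesis unfolding input_def by simp
  qed
  show ?thesis
    unfolding closed_loop_def
  proof (rule exI[of _ "\<lambda>t. h (t - t0)"], rule exI[of _ "\<lambda>t. aR (t - t0)"],
      rule exI[of _ "\<lambda>t. aO (t - t0)"], rule ballI)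
    fix t assume t: "t \<in> {t0..t0 + T}"
    then have t': "t - t0 \<in> {0..T}" by auto
    note shift = has_vector_derivative_shift[OF _ t]
    show "(\<forall>i\<in>robots S.
           ((\<lambda>s. posR (X s) i) has_vector_derivative velR (X t) i) (at t within {t0..t0 + T}) \<and>
           ((\<lambda>s. velR (X s) i) has_vector_derivative aR (t - t0) i) (at t within {t0..t0 + T}) \<and>
           massR S i *\<^sub>R aR (t - t0) i + driftR S i (posR (X t) i, velR (X t) i)
             = input \<mu> X t0 t i - h (t - t0) i \<and>
           ((\<forall>j\<in>objects S. i \<notin> grasp (X t0) j) \<longrightarrow> h (t - t0) i = 0)) \<and>
        (\<forall>j\<in>objects S.
           ((\<lambda>s. posO (X s) j) has_vector_derivative velO (X t) j) (at t within {t0..t0 + T}) \<and>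
           ((\<lambda>s. velO (X s) j) has_vector_derivative aO (t - t0) j) (at t within {t0..t0 + T}) \<and>
           massO S j *\<^sub>R aO (t - t0) j + driftO S j (posO (X t) j, velO (X t) j)
             = (\<Sum>i\<in>grasp (X t0) j. h (t - t0) i) \<and>
           (\<forall>i\<in>grasp (X t0) j.
              posO (X t) j - posR (X t) i = posO (X t0) j - posR (X t0) i))"
      unfolding input[OF t] X0 eq[OF t]
      using bspec[OF * t'] by (auto intro!: shift simp: eq)
  qed
qed

text \<open>Moves an action performed from time 0 to its slot in a longer trajectory;
  \<open>X\<close> is constrained on that slot only.\<close>

lemma achieves_shift:
  assumes ach: "achieves S law a Y 0 T"
    and eq: "\<And>s. s \<in> {t0..t0 + T} \<Longrightarrow> X s = Y (s - t0)"
  shows "achieves S law a X t0 (t0 + T)"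
proof -
  note D = achievesD[OF ach]
  have X0: "X t0 = Y 0" and X1: "X (t0 + T) = Y T"
    using eq[of t0] eq[of "t0 + T"] D(1) by simp_all
  have cl: "closed_loop S (law a) X t0 (t0 + T)"
    by (rule closed_loop_shift[OF D(2) less_imp_le[OF D(1)] eq])
  have gr: "grasp (X t) = grasp (Y 0)" if "t \<in> {t0..<t0 + T}" for t
    using D(4)[of "t - t0"] eq[of t] that by simp
  have mid: "grasp_ok S (X t) \<and>
        (\<forall>i\<in>robots S - moved_robots a. posR (X t) i = posR (Y 0) i) \<and>
        (\<forall>j\<in>objects S - moved_objects a. posO (X t) j = posO (Y 0) j) \<and>
        (\<forall>e\<in>moved_entities a. entity_clear S (X t) e)" if t: "t \<in> {t0..t0 + T}" for t
  proof -
    have "t - t0 \<in> {0..T}" using t by simp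
    then show ?thesis unfolding eq[OF t] by (intro conjI ballI D(5-8))
  qed
  show ?thesis
    unfolding achieves_def X0 X1
    by (intro conjI ballI allI impI cl D(3)) (use D(1,9,10) gr mid in simp_all)
qed

text \<open>Neighbouring closed slots share an end point, where the two descriptions agree because
  each piece starts where its predecessor ends.\<close>

lemma glue_trajectories:
  fixes T :: "nat \<Rightarrow> real" and Y :: "nat \<Rightarrow> real \<Rightarrow> 'b"
  assumes T: "\<And>m. 0 < T m" and Y: "\<And>m. Y m (T m) = Y (Suc m) 0"
  obtains X where "\<And>m s. s \<in> {sum T {..<m}..sum T {..<Suc m}} \<Longrightarrow> X s = Y m (s - sum T {..<m})"
proof -
  define \<theta> where "\<theta> m = sum T {..<m}" for m
  have mono: "strict_mono \<theta>" by (rule strict_mono_Suc_iff[THEN iffD2]) (auto simp: \<theta>_def T)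
  \<comment> \<open>A boundary time is assigned to the later slot. If the durations have a finite
    sum, times beyond all slots get an arbitrary index, and nothing is claimed about them.\<close>
  define idx where "idx s = (LEAST m. s < \<theta> (Suc m))" for s
  define X where "X s = Y (idx s) (s - \<theta> (idx s))" for s
  have X: "X s = Y m (s - \<theta> m)" if "\<theta> m \<le> s" "s < \<theta> (Suc m)" for m s
  proof -
    have "idx s = m" unfolding idx_def
    proof (rule Least_equality)
      fix n assume "s < \<theta> (Suc n)"
      then have "\<theta> m < \<theta> (Suc n)" using that by simp
      then show "m \<le> n" using mono by (simp add: strict_mono_less)
    qed (fact that)
    then show ?thesis by (simp add: X_def)
  qed
  have "X s = Y m (s - \<theta> m)" if "s \<in> {\<theta> m..\<theta> (Suc m)}" for m s
  proof (cases "s = \<theta> (Suc m)")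
    case True
    have "X s = Y (Suc m) 0"
      using X[of "Suc m" s] strict_monoD[OF mono, of "Suc m" "Suc (Suc m)"] True by simp
    also have "\<dots> = Y m (T m)" by (simp add: Y)
    also have "T m = s - \<theta> m" using True by (simp add: \<theta>_def)
    finally show ?thesis .
  qed (use that X in auto)
  then show thesis using that unfolding \<theta>_def by blast
qed

text \<open>The actions of all transitions are numbered consecutively: \<open>action_index len m\<close> is the pair
  of the transition and the position in its schedule that belong to the \<open>m\<close>-th action.\<close>

primrec action_index :: "(nat \<Rightarrow> nat) \<Rightarrow> nat \<Rightarrow> nat \<times> nat" where
  "action_index len 0 = (0, 0)"
| "action_index len (Suc m) = (case action_index len m of
     (l, n) \<Rightarrow> if Suc n < len l then (l, Suc n) else (Suc l, 0))"

text \<open>\<open>sum len {..<l}\<close> counts the actions before transition \<open>l\<close>. The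
  inner induction runs along one schedule, the outer one from schedule to schedule; the last
  position of a schedule leads to the start of the next.\<close>

lemma action_index_sum:
  assumes len: "\<And>l. 0 < len l" and "n < len l"
  shows "action_index len (sum len {..<l} + n) = (l, n)"
proof -
  have row: "action_index len (sum len {..<l} + n) = (l, n)"
    if "action_index len (sum len {..<l}) = (l, 0)" "n < len l" for l n
    using that(2) by (induction n) (use that(1) in auto)
  have "action_index len (sum len {..<l}) = (l, 0)"
  proof (induction l)
    case (Suc l)
    obtain n where n: "len l = Suc n" using len[of l] gr0_implies_Suc by blast
    then show ?case using row[OF Suc, of n] by simp
  qed simp
  then show ?thesis using row assms(2) by blast
qed

text \<open>Since no schedule is empty, the position 0 reached after a jump is valid.\<close>

lemma action_index_less:
  assumes "\<And>l. 0 < len l" "action_index len m = (l, n)"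
  shows "n < len l"
  using assms(2) by (induction m arbitrary: l n) (auto simp: assms(1) split: prod.splits if_splits)

section \<open>Existence of executions\<close>

lemma execution_exists:
  assumes "realises S q0 (\<pi> 0)" "q0 \<in> Q"
    and tr: "\<forall>l. ts_trans S (\<pi> l) (\<pi> (Suc l))"
    and sch: "\<forall>l. is_schedule S (\<pi> l) (\<pi> (Suc l)) (sched l)"
    and law: "\<forall>l. laws_available S Q law (\<pi> l) (sched l)"
  shows "\<exists>X \<tau>. execution S law sched q0 X \<tau>"
proof -
  define len where "len l = length (sched l)" for l
  have len: "0 < len l" for l
    using is_schedule_nonempty[OF sch[rule_format, of l]] by (simp add: len_def)
  define act where "act m = (case action_index len m of (l, n) \<Rightarrow> sched l ! n)" for m
  define st where
    "st m = (case action_index len m of (l, n) \<Rightarrow> fold state_after (take n (sched l)) (\<pi> l))" for m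
  \<comment> \<open>The facts recorded about the end point are what is required for starting the
    next law there.\<close>
  define good where "good m T Y \<longleftrightarrow> 0 < T \<and> achieves S law (act m) Y 0 T \<and> Y T \<in> Q \<and>
    realises S (Y 0) (st m) \<and> realises S (Y T) (st (Suc m))" for m T Y
  have step: "\<exists>T Y. Y 0 = q \<and> good m T Y" if q: "q \<in> Q" "realises S q (st m)" for q m
  proof -
    obtain l n where ln: "action_index len m = (l, n)" by fastforce
    have n: "n < length (sched l)" using action_index_less[where len = len, OF len ln] by (simp add: len_def)
    have tr_l: "ts_trans S (\<pi> l) (\<pi> (Suc l))" using tr by blast
    have sch_l: "is_schedule S (\<pi> l) (\<pi> (Suc l)) (sched l)" using sch by blast
    have act: "act m = sched l ! n" by (simp add: act_def ln)
    have st: "st m = fold state_after (take n (sched l)) (\<pi> l)" by (simp add: st_def ln)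
    obtain T Y where TY: "0 < T" "Y 0 = q" "achieves S law (act m) Y 0 T" "Y T \<in> Q"
      using law n q unfolding laws_available_def act st by blast
    have "act m \<in> prescribed S (\<pi> l) (\<pi> (Suc l)) \<or> act m = Idle"
      using is_schedule_mem_iff[OF sch_l, of "act m"] n act by auto
    then have "realises S (Y T) (state_after (act m) (st m))"
      using realises_achieves TY q by metis
    then have re: "realises S (Y T) (fold state_after (take (Suc n) (sched l)) (\<pi> l))"
      using n by (simp add: act st take_Suc_conv_app_nth)
    have "realises S (Y T) (st (Suc m))"
    proof (cases "Suc n < len l")
      case True
      then show ?thesis using re by (simp add: st_def ln)
    next
      \<comment> \<open>After the last action of a schedule, \<open>st (Suc m)\<close> is
        \<open>\<pi> (Suc l)\<close> itself, no longer a fold over the old schedule.\<close>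
      case False
      then have "take (Suc n) (sched l) = sched l" by (simp add: len_def)
      then show ?thesis
        using False re realises_after_schedule[OF tr_l sch_l] by (simp add: st_def ln)
    qed
    then show ?thesis unfolding good_def using TY q by blast
  qed
  \<comment> \<open>Dependent choice over all actions. One predicate covers every \<open>m\<close>,
    so the initial condition is guarded by \<open>m = 0\<close>.\<close>
  have "\<exists>f. \<forall>m. (case f m of (T, Y) \<Rightarrow> good m T Y \<and> (m = 0 \<longrightarrow> Y 0 = q0)) \<and>
      (case (f m, f (Suc m)) of ((T, Y), (T', Y')) \<Rightarrow> Y' 0 = Y T)"
  proof (rule dependent_nat_choice)
    show "\<exists>x. case x of (T, Y) \<Rightarrow> good 0 T Y \<and> ((0::nat) = 0 \<longrightarrow> Y 0 = q0)"
      using step[of q0 0] assms(1,2) by (auto simp: st_def)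
  next
    fix x and m
    assume "case x of (T, Y) \<Rightarrow> good m T Y \<and> (m = 0 \<longrightarrow> Y 0 = q0)"
    then obtain T Y where x: "x = (T, Y)" "good m T Y" by auto
    then show "\<exists>y. (case y of (T, Y) \<Rightarrow> good (Suc m) T Y \<and> (Suc m = 0 \<longrightarrow> Y 0 = q0)) \<and>
        (case (x, y) of ((T, Y), (T', Y')) \<Rightarrow> Y' 0 = Y T)"
      using step[of "Y T" "Suc m"] by (auto simp: good_def)
  qed
  then obtain f where f: "\<And>m. (case f m of (T, Y) \<Rightarrow> good m T Y \<and> (m = 0 \<longrightarrow> Y 0 = q0)) \<and>
      (case (f m, f (Suc m)) of ((T, Y), (T', Y')) \<Rightarrow> Y' 0 = Y T)" by blast
  define T Y where "T m = fst (f m)" and "Y m = snd (f m)" for m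
  have good: "good m (T m) (Y m)" and Y0: "Y 0 0 = q0" and Y: "Y m (T m) = Y (Suc m) 0" for m
    using f[of m] f[of 0] by (auto simp: T_def Y_def split: prod.splits)
  have T: "0 < T m" for m using good[of m] by (simp add: good_def)
  define \<theta> where "\<theta> m = sum T {..<m}" for m
  obtain X where X: "\<And>m s. s \<in> {\<theta> m..\<theta> (Suc m)} \<Longrightarrow> X s = Y m (s - \<theta> m)"
    unfolding \<theta>_def using glue_trajectories[of T Y] T Y by blast
  have \<theta>_Suc: "\<theta> (Suc m) = \<theta> m + T m" for m by (simp add: \<theta>_def)
  have ach: "achieves S law (act m) X (\<theta> m) (\<theta> (Suc m))" for m
    unfolding \<theta>_Suc
    by (rule achieves_shift[where Y = "Y m"]) (use good[of m] X \<theta>_Suc in \<open>auto simp: good_def\<close>)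
  \<comment> \<open>Transition \<open>l\<close> starts once the \<open>sum len {..<l}\<close>
    actions of the earlier transitions are completed.\<close>
  have "execution S law sched q0 X (\<lambda>l. \<theta> (sum len {..<l}))"
    unfolding execution_def
  proof (intro conjI allI)
    show "X 0 = q0" using X[of 0 0] T[of 0] Y0 by (simp add: \<theta>_def)
    show "\<theta> (sum len {..<0}) = 0" by (simp add: \<theta>_def)
    fix l
    show "\<exists>\<theta>'. \<theta>' 0 = \<theta> (sum len {..<l}) \<and> \<theta>' (length (sched l)) = \<theta> (sum len {..<Suc l}) \<and>
        (\<forall>n<length (sched l). achieves S law (sched l ! n) X (\<theta>' n) (\<theta>' (Suc n)))"
    proof (intro exI[of _ "\<lambda>n. \<theta> (sum len {..<l} + n)"] conjI allI impI)
      fix n assume "n < length (sched l)"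
      then have "act (sum len {..<l} + n) = sched l ! n"
        using action_index_sum[where len = len and n = n and l = l] len by (simp add: act_def len_def)
      then show "achieves S law (sched l ! n) X (\<theta> (sum len {..<l} + n)) (\<theta> (sum len {..<l} + Suc n))"
        using ach[of "sum len {..<l} + n"] by simp
    qed (simp_all add: len_def)
  qed
  then show ?thesis by blast
qed

section \<open>Satisfaction of the individual formulas\<close>

theorem theorem1:
  fixes S :: "'ap scenario"
    and ini inio :: "nat \<Rightarrow> nat"
    and q0 :: pstate
    and \<phi>R \<phi>O :: "nat \<Rightarrow> 'ap ltl"
    and \<pi> :: "tstate word"
    and law :: "action \<Rightarrow> feedback"
    and sched :: "nat \<Rightarrow> action list"
    and Q :: "pstate set"
  assumes "well_posed S"
    and "disjoint_family_on (case_sum (APR S) (APO S)) (robots S <+> objects S)"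
    and "\<forall>i\<in>robots S. atoms_ltl (\<phi>R i) \<subseteq> APR S i"
    and "\<forall>j\<in>objects S. atoms_ltl (\<phi>O j) \<subseteq> APO S j"
    and "ini \<in> robots S \<rightarrow> regions S" and "inio \<in> objects S \<rightarrow> regions S"
    and "\<forall>i\<in>robots S. volR S q0 i \<subseteq> region S (ini i) \<and> velR q0 i = 0"
    and "\<forall>j\<in>objects S. volO S q0 j \<subseteq> region S (inio j) \<and> velO q0 j = 0"
    and "grasp_ok S q0" and "collision_free S q0"
    and "\<pi> 0 \<in> ts_init S ini inio (grasp q0)"
    and "\<forall>l. ts_trans S (\<pi> l) (\<pi> (Suc l))"
    and "\<exists>pre suf. suf \<noteq> [] \<and> \<pi> = pre \<frown> suf\<^sup>\<omega>"
    and "(\<lambda>l. ts_label S (\<pi> l)) \<Turnstile>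
           LAnd (ltl_Conj (map \<phi>R [1..<Suc (nR S)])) (ltl_Conj (map \<phi>O [1..<Suc (nO S)]))"
    and "\<forall>l. is_schedule S (\<pi> l) (\<pi> (Suc l)) (sched l)"
    and "q0 \<in> Q" and "\<forall>l. laws_available S Q law (\<pi> l) (sched l)"
  shows "(\<exists>X \<tau>. execution S law sched q0 X \<tau>) \<and>
    (\<forall>X \<tau>. execution S law sched q0 X \<tau> \<longrightarrow>
       (\<exists>\<beta>R \<beta>O.
          (\<forall>i\<in>robots S.
             is_behavior S (exec_time \<tau>) (\<lambda>t. posR (X t) i) (radR S i) (labR S i) (\<beta>R i) \<and>
             behavior_sat (\<beta>R i) (\<phi>R i)) \<and>
          (\<forall>j\<in>objects S.
             is_behavior S (exec_time \<tau>) (\<lambda>t. posO (X t) j) (radO S j) (labO S j) (\<beta>O j) \<and>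
             behavior_sat (\<beta>O j) (\<phi>O j))))"
proof -
  have st: "\<pi> l \<in> ts_states S" for l using assms(12) by (auto simp: ts_trans_def)
  have re0: "realises S q0 (\<pi> 0)"
    using assms(7,8,11) by (auto simp: realises_def ts_init_def)
  have satR: "(\<lambda>l. labR S i (region S (regR (\<pi> l) i))) \<Turnstile> \<phi>R i" if i: "i \<in> robots S" for i
  proof -
    have "(\<lambda>l. ts_label S (\<pi> l)) \<Turnstile> \<phi>R i"
      using assms(14) i by (simp add: robots_def del: upt_Suc)
    then show ?thesis
      \<comment> \<open>On the propositions of \<open>i\<close>, the full trace and the label
        sequence of \<open>i\<close> agree.\<close>
      by (subst ltl_sat_cong[where A = "APR S i" and w' = "\<lambda>l. ts_label S (\<pi> l)"])
        (use assms(1-3) i st ts_label_Int_APR in blast)+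
  qed
  have satO: "(\<lambda>l. labO S j (region S (regO (\<pi> l) j))) \<Turnstile> \<phi>O j" if j: "j \<in> objects S" for j
  proof -
    have "(\<lambda>l. ts_label S (\<pi> l)) \<Turnstile> \<phi>O j"
      using assms(14) j by (simp add: objects_def del: upt_Suc)
    then show ?thesis
      by (subst ltl_sat_cong[where A = "APO S j" and w' = "\<lambda>l. ts_label S (\<pi> l)"])
        (use assms(1,2,4) j st ts_label_Int_APO in blast)+
  qed
  show ?thesis
  proof (intro conjI allI impI)
    show "\<exists>X \<tau>. execution S law sched q0 X \<tau>"
      by (rule execution_exists[OF re0 assms(16,12,15,17)])
  next
    fix X \<tau> assume ex: "execution S law sched q0 X \<tau>"
    note run = execution_realises[OF ex re0 assms(12,15)]
    have mono: "strict_mono \<tau>" using run(2) by (simp add: strict_mono_Suc_iff)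
    have \<tau>: "0 \<le> \<tau> l \<and> \<tau> l \<in> exec_time \<tau>" for l
    proof -
      have "\<tau> 0 \<le> \<tau> l" using mono by (simp add: strict_mono_less_eq)
      then show ?thesis using ex by (auto simp: execution_def exec_time_def)
    qed
    show "\<exists>\<beta>R \<beta>O.
          (\<forall>i\<in>robots S.
             is_behavior S (exec_time \<tau>) (\<lambda>t. posR (X t) i) (radR S i) (labR S i) (\<beta>R i) \<and>
             behavior_sat (\<beta>R i) (\<phi>R i)) \<and>
          (\<forall>j\<in>objects S.
             is_behavior S (exec_time \<tau>) (\<lambda>t. posO (X t) j) (radO S j) (labO S j) (\<beta>O j) \<and>
             behavior_sat (\<beta>O j) (\<phi>O j))"
    \<comment> \<open>All behaviors share the time stamps \<open>\<tau> l\<close>, with labels read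
      off the path. The first stamp is \<open>\<tau> 0 = 0\<close>, so the initial configuration
      gives the first letter.\<close>
    proof (rule exI[of _ "\<lambda>i l. (posR (X (\<tau> l)) i, labR S i (region S (regR (\<pi> l) i)))"],
        rule exI[of _ "\<lambda>j l. (posO (X (\<tau> l)) j, labO S j (region S (regO (\<pi> l) j)))"],
        intro conjI ballI)
      fix i assume i: "i \<in> robots S"
      have "regR (\<pi> l) i \<in> regions S" "cball (posR (X (\<tau> l)) i) (radR S i) \<subseteq> region S (regR (\<pi> l) i)"
        for l using st[of l] run(1)[of l] i by (auto simp: ts_states_regions realises_def volR_def)
      then show "is_behavior S (exec_time \<tau>) (\<lambda>t. posR (X t) i) (radR S i) (labR S i)
          (\<lambda>l. (posR (X (\<tau> l)) i, labR S i (region S (regR (\<pi> l) i))))"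
        unfolding is_behavior_def using mono \<tau>
        by (intro exI[of _ \<tau>] exI[of _ "\<lambda>l. labR S i (region S (regR (\<pi> l) i))"]) blast
      show "behavior_sat (\<lambda>l. (posR (X (\<tau> l)) i, labR S i (region S (regR (\<pi> l) i)))) (\<phi>R i)"
        using satR[OF i] by (simp add: behavior_sat_def comp_def)
    next
      fix j assume j: "j \<in> objects S"
      have "regO (\<pi> l) j \<in> regions S" "cball (posO (X (\<tau> l)) j) (radO S j) \<subseteq> region S (regO (\<pi> l) j)"
        for l using st[of l] run(1)[of l] j by (auto simp: ts_states_regions realises_def volO_def)
      then show "is_behavior S (exec_time \<tau>) (\<lambda>t. posO (X t) j) (radO S j) (labO S j)
          (\<lambda>l. (posO (X (\<tau> l)) j, labO S j (region S (regO (\<pi> l) j))))"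
        unfolding is_behavior_def using mono \<tau>
        by (intro exI[of _ \<tau>] exI[of _ "\<lambda>l. labO S j (region S (regO (\<pi> l) j))"]) blast
      show "behavior_sat (\<lambda>l. (posO (X (\<tau> l)) j, labO S j (region S (regO (\<pi> l) j)))) (\<phi>O j)"
        using satO[OF j] by (simp add: behavior_sat_def comp_def)
    qed
  qed
qed

end
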